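(* Let $G$ be a twin-free finite simple graph with no isolated vertices such that $\det(G) = k \geq 2$. Then for every integer $t \geq \lceil \log_2(k+1)\rceil - 1$, \[ \det(\mu^{(t)}(G)) = k, \quad \dist(\mu^{(t)}(G)) = 2, \quad \text{and} \quad \rho(\mu^{(t)}(G)) \leq \frac{(k+1)\lceil \log_2(k+1)\rceil}{2}. \]
   Context: For $t \in \mathbb{N}$ and a graph $G$ with $V(G)=\{v_1,\dots,v_n\}$, the generalized Mycielskian $\mu^{(t)}(G)$ has vertex set $\{u_i^s : 1\le i\le n,\ 0\le s\le t\} \cup \{w\}$, with $u_i^0$ identified with $v_i$. For each edge $v_iv_j$ of $G$ it has edges $u_i^0u_j^0$ and $u_i^su_j^{s+1}$, $u_j^su_i^{s+1}$ for $0 \le s < t$; also edges $u_i^t w$ for $1 \le i \le n$; no other edges. A determining set of a graph $H$ is a vertex set $S$ such that the only automorphism fixing every vertex of $S$ is the identity; $\det(H)$ is the minimum size of one. A coloring of $V(H)$ with $d$ colors is distinguishing if only the identity automorphism preserves each color class; $\dist(H)$ is the least $d$ admitting a distinguishing $d$-coloring. If $\dist(H)=2$, the cost $\rho(H)$ is the minimum, over all distinguishing $2$-colorings, of the size of the smaller color class. Twins are vertices with equal open neighborhoods; twin-free means no pair of distinct twins. *)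

theory Defs
  imports Complex_Main "Graph_Theory.Pair_Digraph"
begin

text \<open>
  A finite simple graph is a \<open>pair_graph\<close>: a finite, loop-free, symmetric arc relation, so every
  undirected edge is represented by its two arcs. It is not required to be connected.
\<close>

definition nbhd :: "'a pair_pre_digraph \<Rightarrow> 'a \<Rightarrow> 'a set" where
  "nbhd G v = {u. (v, u) \<in> parcs G}"

definition twin_free :: "'a pair_pre_digraph \<Rightarrow> bool" where
  "twin_free G \<longleftrightarrow> (\<forall>u\<in>pverts G. \<forall>v\<in>pverts G. u \<noteq> v \<longrightarrow> nbhd G u \<noteq> nbhd G v)"

definition no_isolated :: "'a pair_pre_digraph \<Rightarrow> bool" where
  "no_isolated G \<longleftrightarrow> (\<forall>v\<in>pverts G. nbhd G v \<noteq> {})"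

text \<open>
  Automorphisms are functions on the whole type of which only the values on the vertex set matter;
  accordingly, being the identity is a condition on the vertex set only.
\<close>

definition automorphism :: "'a pair_pre_digraph \<Rightarrow> ('a \<Rightarrow> 'a) \<Rightarrow> bool" where
  "automorphism G f \<longleftrightarrow> bij_betw f (pverts G) (pverts G) \<and>
     (\<forall>u\<in>pverts G. \<forall>v\<in>pverts G. (f u, f v) \<in> parcs G \<longleftrightarrow> (u, v) \<in> parcs G)"

definition determining :: "'a pair_pre_digraph \<Rightarrow> 'a set \<Rightarrow> bool" where
  "determining G S \<longleftrightarrow> S \<subseteq> pverts G \<and>
     (\<forall>f. automorphism G f \<and> (\<forall>v\<in>S. f v = v) \<longrightarrow> (\<forall>v\<in>pverts G. f v = v))"

definition det_number :: "'a pair_pre_digraph \<Rightarrow> nat" where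
  "det_number G = (LEAST m. \<exists>S. determining G S \<and> card S = m)"

definition color_class :: "'a pair_pre_digraph \<Rightarrow> ('a \<Rightarrow> nat) \<Rightarrow> nat \<Rightarrow> 'a set" where
  "color_class G c i = {v \<in> pverts G. c v = i}"

text \<open>Colorings need not be proper, and some of the \<open>d\<close> colors may be unused.\<close>

definition distinguishing :: "'a pair_pre_digraph \<Rightarrow> nat \<Rightarrow> ('a \<Rightarrow> nat) \<Rightarrow> bool" where
  "distinguishing G d c \<longleftrightarrow> c ` pverts G \<subseteq> {..<d} \<and>
     (\<forall>f. automorphism G f \<and> (\<forall>i<d. f ` color_class G c i = color_class G c i)
        \<longrightarrow> (\<forall>v\<in>pverts G. f v = v))"

definition dist_number :: "'a pair_pre_digraph \<Rightarrow> nat" where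
  "dist_number G = (LEAST d. \<exists>c. distinguishing G d c)"

text \<open>Meaningful only if \<open>dist_number G = 2\<close>.\<close>

definition cost :: "'a pair_pre_digraph \<Rightarrow> nat" where
  "cost G = (LEAST m. \<exists>c. distinguishing G 2 c \<and>
     m = min (card (color_class G c 0)) (card (color_class G c 1)))"

text \<open>
  \<open>U v s\<close> is the copy of the vertex \<open>v\<close> at level \<open>s\<close>; level 0 is the original graph, and \<open>W\<close> is the
  extra vertex adjacent to the whole top level \<open>t\<close>.
\<close>

datatype 'a myc_vertex = U 'a nat | W

definition mycielskian :: "nat \<Rightarrow> 'a pair_pre_digraph \<Rightarrow> 'a myc_vertex pair_pre_digraph" where
  "mycielskian t G = \<lparr>
     pverts = {U v s | v s. v \<in> pverts G \<and> s \<le> t} \<union> {W},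
     parcs = {(U u 0, U v 0) | u v. (u, v) \<in> parcs G}
       \<union> {(U u s, U v (Suc s)) | u v s. (u, v) \<in> parcs G \<and> s < t}
       \<union> {(U v (Suc s), U u s) | u v s. (u, v) \<in> parcs G \<and> s < t}
       \<union> {(U v t, W) | v. v \<in> pverts G}
       \<union> {(W, U v t) | v. v \<in> pverts G} \<rparr>"

lemma pair_graph_mycielskian:
  assumes "pair_graph G"
  shows "pair_graph (mycielskian t G)"
proof -
  interpret pair_graph G by fact
  have sym: "(v, u) \<in> parcs G" if "(u, v) \<in> parcs G" for u v
    using pair_sym_arcs that by (auto simp: symmetric_def elim: symE)
  have wf: "u \<in> pverts G" "v \<in> pverts G" if "(u, v) \<in> parcs G" for u v
    using in_arcsD1[OF that] in_arcsD2[OF that] .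
  have irr: "(u, u) \<notin> parcs G" for u
    using pair_no_loops by fastforce
  let ?V = "pverts (mycielskian t G)" and ?A = "parcs (mycielskian t G)"
  have "{U v s | v s. v \<in> pverts G \<and> s \<le> t} = (\<lambda>(v, s). U v s) ` (pverts G \<times> {..t})"
    by auto
  then have fin: "finite ?V"
    using pair_finite_verts by (simp add: mycielskian_def)
  have sub: "?A \<subseteq> ?V \<times> ?V"
    by (auto simp: mycielskian_def dest: wf)
  have finA: "finite ?A"
    using finite_subset[OF sub] fin by blast
  have "sym ?A"
    by (rule symI) (auto simp: mycielskian_def dest: sym)
  moreover have "fst e \<noteq> snd e" if "e \<in> ?A" for e
    using that irr by (auto simp: mycielskian_def)
  ultimately show ?thesis
    using sub fin finA by unfold_locales (auto simp: symmetric_def)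
qed

end

theory Submission
  imports Defs
begin

text \<open>
  The main point is that an automorphism of \<open>\<mu>\<^sup>t(G)\<close> fixes \<open>W\<close>. Suppose that it sends \<open>W\<close> to
  \<open>U i s\<close>. If \<open>s = t\<close>, or if some vertex of level \<open>0\<close> has the maximal distance \<open>t + 1\<close> from
  \<open>U i s\<close>, the vertex \<open>W\<close> has no partner sharing its neighbors at the next distance from \<open>U i s\<close>,
  as the layering around \<open>W\<close> requires (\<open>shadow\<close> below). Otherwise the parity of the distance from
  \<open>U i s\<close> is a proper 2-coloring of \<open>G\<close>, so deleting \<open>W\<close>, and hence also deleting
  \<open>U i s\<close>, leaves a bipartite graph. But an edge of \<open>G\<close> avoiding \<open>i\<close>, which exists because a
  twin-free star has determining number at most 1, spans together with \<open>W\<close> an odd cycle.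
  Once \<open>W\<close> is fixed, levels are preserved, and as \<open>G\<close> is twin-free every automorphism acts on all
  levels by one and the same automorphism of \<open>G\<close>.
\<close>

section \<open>Preliminaries: inverse automorphisms, determining sets, families of small
  sets\<close>

lemma automorphism_inv_into:
  assumes "automorphism H f"
  shows "automorphism H (inv_into (pverts H) f)"
  unfolding automorphism_def
proof (intro conjI ballI)
  let ?g = "inv_into (pverts H) f"
  have bij: "bij_betw f (pverts H) (pverts H)"
    and arcs: "\<And>u v. u \<in> pverts H \<Longrightarrow> v \<in> pverts H \<Longrightarrow>
      (f u, f v) \<in> parcs H \<longleftrightarrow> (u, v) \<in> parcs H"
    using assms by (auto simp: automorphism_def)
  show g: "bij_betw ?g (pverts H) (pverts H)"
    using bij by (rule bij_betw_inv_into)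
  fix u v assume "u \<in> pverts H" "v \<in> pverts H"
  then show "(?g u, ?g v) \<in> parcs H \<longleftrightarrow> (u, v) \<in> parcs H"
    using arcs[of "?g u" "?g v"] bij_betwE[OF g] bij_betw_inv_into_right[OF bij] by simp
qed

lemma determining_verts: "determining G (pverts G)"
  by (simp add: determining_def)

lemma determining_det_number:
  obtains S where "determining G S" "card S = det_number G"
proof -
  have "\<exists>S. determining G S \<and> card S = det_number G"
    unfolding det_number_def
    by (rule LeastI_ex) (use determining_verts in blast)
  then show thesis using that by blast
qed

lemma det_number_le: "determining G S \<Longrightarrow> det_number G \<le> card S"
  unfolding det_number_def by (rule Least_le) blast

text \<open>Of the \<open>m\<close> sets, the larger half avoids the new element \<open>r\<close>
  and the smaller half contains it, so each element costs at most \<open>m / 2\<close> incidences.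
  The larger half keeps the empty set, which is discarded later so that only nonempty labels
  remain.\<close>

lemma small_subset_family:
  assumes "m \<le> 2 ^ r"
  shows "\<exists>F. F \<subseteq> Pow {..<r} \<and> card F = m \<and> (m > 0 \<longrightarrow> {} \<in> F)
    \<and> 2 * (\<Sum>A\<in>F. card A) \<le> m * r"
  using assms
proof (induction r arbitrary: m)
  case 0
  then consider "m = 0" | "m = 1" by fastforce
  then show ?case
    by cases (rule exI[of _ "{}"], simp, rule exI[of _ "{{}}"], simp)
next
  case (Suc r)
  define a where "a = (m + 1) div 2"
  define b where "b = m div 2"
  have ab: "a + b = m" "a \<le> 2 ^ r" "b \<le> 2 ^ r" "2 * b \<le> m" "m > 0 \<Longrightarrow> a > 0"
    using Suc.prems by (auto simp: a_def b_def)
  obtain F where F: "F \<subseteq> Pow {..<r}" "card F = a" "a > 0 \<longrightarrow> {} \<in> F"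
    "2 * (\<Sum>A\<in>F. card A) \<le> a * r"
    using Suc.IH[OF ab(2)] by (elim exE conjE)
  obtain F' where F': "F' \<subseteq> Pow {..<r}" "card F' = b" "2 * (\<Sum>A\<in>F'. card A) \<le> b * r"
    using Suc.IH[OF ab(3)] by (elim exE conjE)
  have fin: "finite F" "finite F'"
    using F(1) F'(1) finite_subset by auto
  have notin: "r \<notin> A" "finite A" if "A \<in> F \<union> F'" for A
    using that F(1) F'(1) finite_subset[of A "{..<r}"] by auto
  have inj: "inj_on (insert r) F'"
    using notin by (intro inj_onI) (metis UnI2 insert_ident)
  have disj: "F \<inter> insert r ` F' = {}"
    using notin by auto
  have "(\<Sum>A\<in>insert r ` F'. card A) = (\<Sum>A\<in>F'. Suc (card A))"
    using notin by (subst sum.reindex[OF inj]) (auto intro!: sum.cong)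
  also have "\<dots> = (\<Sum>A\<in>F'. card A) + b"
    using F'(2) sum.distrib[of card "\<lambda>_. 1" F'] by simp
  finally have sum: "(\<Sum>A\<in>F \<union> insert r ` F'. card A) = (\<Sum>A\<in>F. card A) + (\<Sum>A\<in>F'. card A) + b"
    using fin disj by (simp add: sum.union_disjoint)
  have "2 * (\<Sum>A\<in>F \<union> insert r ` F'. card A) \<le> a * r + b * r + 2 * b"
    unfolding sum using F(4) F'(3) by simp
  also have "\<dots> \<le> m * Suc r"
    using ab(1,4) by (auto simp: algebra_simps)
  finally have le: "2 * (\<Sum>A\<in>F \<union> insert r ` F'. card A) \<le> m * Suc r" .
  have "card (F \<union> insert r ` F') = m"
    using fin disj F(2) F'(2) ab(1) inj by (simp add: card_Un_disjoint card_image)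
  moreover have "F \<union> insert r ` F' \<subseteq> Pow {..<Suc r}"
    using F(1) F'(1) by (fastforce simp: lessThan_Suc)
  ultimately show ?case
    using le F(3) ab(5) by (intro exI[of _ "F \<union> insert r ` F'"]) auto
qed

section \<open>Vertices and arcs of the generalized Mycielskian\<close>

locale myc =
  fixes G :: "'a pair_pre_digraph" and t :: nat
  assumes G: "pair_graph G" and no_iso: "no_isolated G"
begin

sublocale pair_graph G by (rule G)

abbreviation "V \<equiv> pverts G"
abbreviation "E \<equiv> parcs G"
abbreviation "H \<equiv> mycielskian t G"
abbreviation "VH \<equiv> pverts (mycielskian t G)"
abbreviation "EH \<equiv> parcs (mycielskian t G)"

lemma E_sym: "(u, v) \<in> E \<Longrightarrow> (v, u) \<in> E"
  using pair_sym_arcs by (auto simp: symmetric_def elim: symE)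

lemma E_verts: "(u, v) \<in> E \<Longrightarrow> u \<in> V" "(u, v) \<in> E \<Longrightarrow> v \<in> V"
  using in_arcsD1 in_arcsD2 by auto

lemma E_irrefl: "(u, u) \<notin> E"
  using pair_no_loops by fastforce

lemma E_ex: "v \<in> V \<Longrightarrow> \<exists>u. (v, u) \<in> E"
  using no_iso by (auto simp: no_isolated_def nbhd_def)

lemma W_VH [simp]: "W \<in> VH"
  and U_VH [simp]: "U v p \<in> VH \<longleftrightarrow> v \<in> V \<and> p \<le> t"
  by (auto simp: mycielskian_def)

lemma UU_EH [simp]: "(U u p, U v q) \<in> EH \<longleftrightarrow>
    (u, v) \<in> E \<and> p \<le> t \<and> q \<le> t \<and> (p = 0 \<and> q = 0 \<or> q = Suc p \<or> p = Suc q)"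
  and UW_EH [simp]: "(U u p, W) \<in> EH \<longleftrightarrow> u \<in> V \<and> p = t"
  and WU_EH [simp]: "(W, U u p) \<in> EH \<longleftrightarrow> u \<in> V \<and> p = t"
  and WW_EH [simp]: "(W, W) \<notin> EH"
  by (auto simp: mycielskian_def intro: E_sym)

lemma EH_sym: "(u, v) \<in> EH \<Longrightarrow> (v, u) \<in> EH"
  by (cases u; cases v) (auto intro: E_sym)

lemma EH_verts: "(u, v) \<in> EH \<Longrightarrow> u \<in> VH" "(u, v) \<in> EH \<Longrightarrow> v \<in> VH"
  by (cases u; cases v; auto dest: E_verts)+

lemma finite_VH: "finite VH"
proof -
  interpret M: pair_graph H by (rule pair_graph_mycielskian[OF G])
  show ?thesis by simp
qed

lemma automorphism_bij:
  assumes "automorphism H f"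
  shows "bij_betw f VH VH"
  using assms by (simp add: automorphism_def)

lemma automorphism_arc:
  assumes "automorphism H f" "u \<in> VH" "v \<in> VH"
  shows "(f u, f v) \<in> EH \<longleftrightarrow> (u, v) \<in> EH"
  using assms by (auto simp: automorphism_def)

end

section \<open>Distances from a possible image of \<open>W\<close>\<close>

text \<open>
  \<open>\<delta>\<close> is the distance from \<open>U i s\<close>. The axioms hold for the distance from \<open>W\<close>, hence also for
  the distance from the image \<open>U i s\<close> of \<open>W\<close> under an automorphism. In \<open>shadow\<close> for \<open>W\<close>, the
  partner of \<open>U l p\<close> is \<open>U l (p - 2)\<close>, where the levels below \<open>0\<close> are reflected:
  level \<open>-1\<close> is level \<open>0\<close> and level \<open>-2\<close> is level \<open>1\<close>.
\<close>

locale layered_myc = myc +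
  fixes \<delta> :: "'a myc_vertex \<Rightarrow> nat" and i :: 'a and s :: nat
  assumes t_pos: "t \<ge> 1"
    and root: "i \<in> V" "s \<le> t"
    and zero_iff: "v \<in> VH \<Longrightarrow> \<delta> v = 0 \<longleftrightarrow> v = U i s"
    and arc: "(u, v) \<in> EH \<Longrightarrow>
      \<delta> u = Suc (\<delta> v) \<or> \<delta> v = Suc (\<delta> u) \<or> \<delta> u = Suc t \<and> \<delta> v = Suc t"
    and le: "v \<in> VH \<Longrightarrow> \<delta> v \<le> Suc t"
    and pred: "v \<in> VH \<Longrightarrow> \<delta> v > 0 \<Longrightarrow> \<exists>u. (u, v) \<in> EH \<and> \<delta> v = Suc (\<delta> u)"
    and shadow: "v \<in> VH \<Longrightarrow> \<delta> v > 0 \<Longrightarrow> \<exists>v'\<in>VH. v' \<noteq> v \<and>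
      (\<forall>u\<in>VH. \<delta> u = min (Suc (\<delta> v)) (Suc t) \<longrightarrow> ((v, u) \<in> EH \<longleftrightarrow> (v', u) \<in> EH))"
begin

lemma root_zero: "\<delta> (U i s) = 0"
  using zero_iff root by simp

lemma arc_le: "(u, v) \<in> EH \<Longrightarrow> \<delta> v \<le> Suc (\<delta> u)"
  using arc[of u v] by auto

lemma walk_verts: "(i, l) \<in> E ^^ n \<Longrightarrow> l \<in> V"
  using root by (cases n) (auto dest: E_verts)

text \<open>A walk of \<open>G\<close> lifts to one that descends a level at each step and then
  moves inside level 0; truncated subtraction describes both phases.\<close>

lemma lift_down: "(i, l) \<in> E ^^ n \<Longrightarrow> \<delta> (U l (s - n)) \<le> n"
proof (induction n arbitrary: l)
  case 0
  then show ?case using root_zero by simp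
next
  case (Suc n)
  then obtain m where m: "(i, m) \<in> E ^^ n" "(m, l) \<in> E" by auto
  then have "(U m (s - n), U l (s - Suc n)) \<in> EH"
    using root by auto
  from arc_le[OF this] Suc.IH[OF m(1)] show ?case by simp
qed

lemma lift_up: "(i, l) \<in> E ^^ n \<Longrightarrow> s + n \<le> t \<Longrightarrow> \<delta> (U l (s + n)) \<le> n"
proof (induction n arbitrary: l)
  case 0
  then show ?case using root_zero by simp
next
  case (Suc n)
  then obtain m where m: "(i, m) \<in> E ^^ n" "(m, l) \<in> E" by auto
  then have "(U m (s + n), U l (s + Suc n)) \<in> EH"
    using Suc.prems by auto
  from arc_le[OF this] Suc.IH[OF m(1)] Suc.prems show ?case by simp
qed

text \<open>A shortest path from \<open>U i s\<close> to \<open>U l p\<close> either avoids \<open>W\<close>, so that it projects to a walk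
  in \<open>G\<close>, or climbs to \<open>W\<close> and descends again.\<close>

lemma shortest_path_cases:
  assumes "v \<in> VH" "\<delta> v = r"
  shows "case v of W \<Rightarrow> Suc t - s \<le> r
    | U l p \<Rightarrow> (i, l) \<in> E ^^ r \<and> p \<le> s + r \<or> Suc t - s + Suc (t - p) \<le> r"
  using assms
proof (induction r arbitrary: v)
  case 0
  then have "v = U i s" using zero_iff by blast
  then show ?case by simp
next
  case (Suc r)
  then obtain u where u: "(u, v) \<in> EH" "\<delta> u = r"
    using pred[of v] by auto
  have IH: "case u of W \<Rightarrow> Suc t - s \<le> r
    | U l p \<Rightarrow> (i, l) \<in> E ^^ r \<and> p \<le> s + r \<or> Suc t - s + Suc (t - p) \<le> r"
    using Suc.IH[OF EH_verts(1)[OF u(1)] u(2)] .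
  show ?case
  proof (cases u)
    case W
    then show ?thesis using IH u(1) by (cases v) auto
  next
    case u': (U m q)
    show ?thesis
    proof (cases v)
      case W
      then show ?thesis using IH u(1) u' by auto
    next
      case (U l p)
      have "(m, l) \<in> E" "p \<le> Suc q" "q \<le> Suc p" "p \<le> t" "q \<le> t"
        using u(1) u' U by auto
      then show ?thesis using IH u' U by auto
    qed
  qed
qed

text \<open>Such an \<open>a\<close> has distance exactly \<open>t + 1\<close> from \<open>i\<close>
  in \<open>G\<close>. A suitable vertex \<open>l\<close> on a shortest path has its copies at
  levels \<open>t\<close> and \<open>t - 2\<close> both in the layer where \<open>W\<close> and its
  partner must have the same neighbors. Adjacency to \<open>U l t\<close> puts the partner at level
  \<open>t - 1\<close>, so it is also adjacent to \<open>U l (t - 2)\<close>, unlike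
  \<open>W\<close>.\<close>

lemma no_far_base_vertex:
  assumes st: "s < t" and a: "a \<in> V" "\<delta> (U a 0) = Suc t"
  shows False
proof -
  have far: "(i, a) \<notin> E ^^ n" if "n \<le> t" for n
  proof
    assume w: "(i, a) \<in> E ^^ n"
    obtain b where b: "(a, b) \<in> E" using E_ex a(1) by blast
    have ext: "(i, a) \<in> E ^^ (n + 2 * j)" for j
    proof (induction j)
      case (Suc j)
      have "(i, b) \<in> E ^^ Suc (n + 2 * j)" using Suc b by auto
      then have "(i, a) \<in> E ^^ Suc (Suc (n + 2 * j))" using E_sym[OF b] by auto
      then show ?case by simp
    qed (use w in simp)
    \<comment> \<open>Going back and forth along an edge at \<open>a\<close> lengthens the walk by
      2; as \<open>s < t\<close>, the interval from \<open>s\<close> to \<open>t\<close> contains a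
      length of either parity. A walk of length at least \<open>s\<close> can descend to level
      0.\<close>
    have "\<exists>j. s \<le> n + 2 * j \<and> n + 2 * j \<le> t"
    proof (cases "s \<le> n")
      case True then show ?thesis using that by (intro exI[of _ 0]) simp
    next
      case False
      then show ?thesis using st by (intro exI[of _ "(Suc s - n) div 2"]) presburger
    qed
    then obtain j where j: "s \<le> n + 2 * j" "n + 2 * j \<le> t" by blast
    have "\<delta> (U a (s - (n + 2 * j))) \<le> n + 2 * j" by (rule lift_down[OF ext])
    then show False using j a(2) by simp
  qed
  \<comment> \<open>A path through \<open>W\<close> down to level 0 has at least
    \<open>t + 2\<close> edges, so a shortest path projects to a walk in \<open>G\<close>.\<close>
  have wa: "(i, a) \<in> E ^^ Suc t"
    using shortest_path_cases[of "U a 0" "Suc t"] a root by auto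
  have split: "\<exists>l. (i, l) \<in> E ^^ m \<and> (l, a) \<in> E ^^ (Suc t - m)" if "m \<le> Suc t" for m
  proof -
    have "(i, a) \<in> E ^^ m O E ^^ (Suc t - m)"
      using wa that by (simp flip: relpow_add)
    then show ?thesis by blast
  qed
  define q where "q = Suc t - s"
  have \<delta>W: "\<delta> W = q"
  proof (rule antisym)
    obtain l where l: "(i, l) \<in> E ^^ (t - s)" using split[of "t - s"] diff_le_self le_SucI by blast
    have "\<delta> (U l t) \<le> t - s" using lift_up[OF l] root by simp
    then show "\<delta> W \<le> q"
      using arc_le[of "U l t" W] walk_verts[OF l] root by (simp add: q_def)
    show "q \<le> \<delta> W" using shortest_path_cases[of W "\<delta> W"] by (simp add: q_def)
  qed
  \<comment> \<open>As \<open>W\<close> has distance \<open>q\<close>, this is the layer in which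
    \<open>shadow\<close> compares \<open>W\<close> with its partner. The cap at
    \<open>t + 1\<close> takes effect only for \<open>s = 0\<close>.\<close>
  define d where "d = min (Suc q) (Suc t)"
  have dt: "d \<le> Suc t" by (simp add: d_def)
  obtain l where l: "(i, l) \<in> E ^^ d" "(l, a) \<in> E ^^ (Suc t - d)"
    using split[OF dt] by blast
  have lV: "l \<in> V" using walk_verts[OF l(1)] .
  have l_far: "(i, l) \<notin> E ^^ n" if "n < d" for n
  proof
    assume "(i, l) \<in> E ^^ n"
    then have "(i, a) \<in> E ^^ (n + (Suc t - d))" using l(2) by (auto simp: relpow_add)
    moreover have "n + (Suc t - d) \<le> t" using that dt by linarith
    ultimately show False using far by blast
  qed
  have lower: "d \<le> \<delta> (U l p)" if "p \<le> t" for p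
  proof (rule ccontr)
    assume less: "\<not> d \<le> \<delta> (U l p)"
    have "(i, l) \<in> E ^^ \<delta> (U l p) \<or> q + Suc (t - p) \<le> \<delta> (U l p)"
      using shortest_path_cases[of "U l p" "\<delta> (U l p)"] that lV by (auto simp: q_def)
    then show False using l_far less by (auto simp: d_def)
  qed
  have top: "\<delta> (U l t) = d"
    using lower[of t] arc_le[of W "U l t"] le[of "U l t"] lV \<delta>W by (simp add: d_def)
  have next_level: "\<delta> (U l (t - 2)) = d"
  proof (cases "s = 0")
    case True
    then show ?thesis
      using lower[of "t - 2"] le[of "U l (t - 2)"] lV st by (simp add: d_def q_def)
  next
    case False
    then have d: "d = Suc (Suc (t - s))" using st by (simp add: d_def q_def)
    \<comment> \<open>The walk climbs to level \<open>t\<close> in \<open>t - s\<close> steps and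
      uses the last two to descend; for \<open>t = 1\<close> the second of these stays in level
      0.\<close>
    then obtain m n where mn: "(i, n) \<in> E ^^ (t - s)" "(n, m) \<in> E" "(m, l) \<in> E"
      using l(1) by auto
    have "\<delta> (U n t) \<le> t - s" using lift_up[OF mn(1)] root by simp
    moreover have "\<delta> (U m (t - 1)) \<le> Suc (\<delta> (U n t))"
      using mn(2) t_pos by (intro arc_le) auto
    moreover have "\<delta> (U l (t - 2)) \<le> Suc (\<delta> (U m (t - 1)))"
      using mn(3) t_pos by (intro arc_le) auto
    ultimately show ?thesis using lower[of "t - 2"] d by simp
  qed
  have "\<delta> W > 0" using \<delta>W st by (simp add: q_def)
  then obtain y where y: "y \<in> VH" "y \<noteq> W"
    "\<And>u. u \<in> VH \<Longrightarrow> \<delta> u = d \<Longrightarrow> (W, u) \<in> EH \<longleftrightarrow> (y, u) \<in> EH"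
    using shadow[of W] \<delta>W by (auto simp: d_def)
  have "(y, U l t) \<in> EH" using y(3)[of "U l t"] top lV by simp
  then obtain c where "y = U c (t - 1)" "(c, l) \<in> E"
    using y(2) t_pos by (cases y) auto
  then have "(y, U l (t - 2)) \<in> EH" using t_pos by auto
  moreover have "(W, U l (t - 2)) \<notin> EH" using t_pos by auto
  ultimately show False using y(3)[of "U l (t - 2)"] next_level lV by simp
qed

text \<open>Now \<open>W\<close> has distance 1 and every \<open>U l t\<close> with
  \<open>l \<noteq> i\<close> has distance 2, so the partner of \<open>W\<close> is adjacent to all
  of these. It is thus some \<open>U c (t - 1)\<close>, and \<open>c \<noteq> i\<close> would make
  \<open>c\<close> adjacent to itself. But \<open>U i (t - 1)\<close> is also adjacent to
  \<open>U a (t - 2)\<close>, which has distance 2 and is not adjacent to \<open>W\<close>.\<close>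

lemma top_root_incident:
  assumes st: "s = t" and ab: "(a, b) \<in> E"
  shows "a = i \<or> b = i"
proof (rule ccontr)
  assume "\<not> ?thesis"
  then have ne: "a \<noteq> i" "b \<noteq> i" by auto
  have V: "a \<in> V" "b \<in> V" using E_verts[OF ab] .
  have pos: "\<delta> v > 0" if "v \<in> VH" "v \<noteq> U i t" for v
    using zero_iff[of v] that st by simp
  have \<delta>W: "\<delta> W = 1"
    using pos[of W] arc_le[of "U i s" W] root st root_zero by simp
  have top: "\<delta> (U l t) = 2" if "l \<in> V" "l \<noteq> i" for l
  proof -
    have "\<delta> (U l t) \<noteq> 1"
    proof
      assume one: "\<delta> (U l t) = 1"
      have "\<exists>u. (u, U l t) \<in> EH \<and> \<delta> (U l t) = Suc (\<delta> u)"
        by (rule pred) (use one that in simp_all)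
      then obtain u where u: "(u, U l t) \<in> EH" "\<delta> u = 0"
        using one by auto
      have "u = U i t" using zero_iff[OF EH_verts(1)[OF u(1)]] u(2) st by simp
      then show False using u(1) t_pos by simp
    qed
    moreover have "\<delta> (U l t) \<le> 2" using arc_le[of W "U l t"] that \<delta>W by simp
    ultimately show ?thesis using pos[of "U l t"] that by fastforce
  qed
  obtain y where y: "y \<in> VH" "y \<noteq> W"
    "\<And>u. u \<in> VH \<Longrightarrow> \<delta> u = 2 \<Longrightarrow> (W, u) \<in> EH \<longleftrightarrow> (y, u) \<in> EH"
    using shadow[of W] \<delta>W t_pos by (auto simp: min_def)
  have adj: "(y, U l t) \<in> EH" if "l \<in> V" "l \<noteq> i" for l
    using y(3)[of "U l t"] top that by simp
  obtain c where c: "y = U c (t - 1)" "c \<in> V"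
    using adj[OF V(1) ne(1)] y(1,2) t_pos by (cases y) auto
  have "c = i"
    using adj[of c] c E_irrefl by auto
  then have ia: "(i, a) \<in> E" "(i, b) \<in> E"
    using adj[OF V(1) ne(1)] adj[OF V(2) ne(2)] c by auto
  have b1: "\<delta> (U b (t - 1)) = 1"
    using arc_le[of "U i s" "U b (t - 1)"] ia st t_pos root_zero pos[of "U b (t - 1)"] V ne by simp
  have a2: "\<delta> (U a (t - 2)) = 2"
  proof -
    have arc1: "(U b (t - 1), U a (t - 2)) \<in> EH"
      using ab t_pos E_sym by auto
    have "\<delta> (U a (t - 2)) > 0" using V ne by (intro pos) auto
    then show ?thesis using arc[OF arc1] b1 t_pos by auto
  qed
  have "(y, U a (t - 2)) \<in> EH" using c \<open>c = i\<close> ia t_pos by auto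
  then show False using y(3)[of "U a (t - 2)"] a2 V t_pos by auto
qed

end

section \<open>Transport of distances and 2-colorings along an automorphism\<close>

context myc
begin

text \<open>This is the distance from \<open>W\<close>: without isolated vertices, every vertex can
  climb one level per step.\<close>

definition depth :: "'a myc_vertex \<Rightarrow> nat" where
  "depth v = (case v of W \<Rightarrow> 0 | U l p \<Rightarrow> Suc t - p)"

lemma depth_pred:
  assumes "v \<in> VH" "v \<noteq> W"
  shows "\<exists>u. (u, v) \<in> EH \<and> depth v = Suc (depth u)"
proof (cases v)
  case (U l p)
  show ?thesis
  proof (cases "p = t")
    case True
    then show ?thesis using U assms by (intro exI[of _ W]) (auto simp: depth_def)
  next
    case False
    obtain m where "(l, m) \<in> E" using E_ex U assms by auto
    then show ?thesis using U assms False E_sym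
      by (intro exI[of _ "U m (Suc p)"]) (auto simp: depth_def)
  qed
qed (use assms in simp)

lemma depth_shadow:
  assumes "v \<in> VH" "v \<noteq> W" "t \<ge> 1"
  shows "\<exists>v'\<in>VH. v' \<noteq> v \<and>
    (\<forall>u\<in>VH. depth u = min (Suc (depth v)) (Suc t) \<longrightarrow> ((v, u) \<in> EH \<longleftrightarrow> (v', u) \<in> EH))"
proof (cases v)
  case (U l p)
  \<comment> \<open>Truncation sends \<open>p = 1\<close> to level 0, the reflection of level -1, so
    only \<open>p = 0\<close> needs a separate case.\<close>
  define v' where "v' = (if p = 0 then U l 1 else U l (p - 2))"
  have "(v, u) \<in> EH \<longleftrightarrow> (v', u) \<in> EH"
    if "u \<in> VH" "depth u = min (Suc (depth v)) (Suc t)" for u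
    using that U assms
    by (cases u) (auto simp: depth_def v'_def min_def split: if_splits)
  moreover have "v' \<in> VH" "v' \<noteq> v" using U assms by (auto simp: v'_def)
  ultimately show ?thesis by blast
qed (use assms in simp)

text \<open>The axioms speak only of adjacency and distance from \<open>W\<close>, so
  \<open>f\<close> carries them to the root \<open>f W\<close>; the distance of \<open>v\<close>
  from \<open>f W\<close> is the depth of its preimage.\<close>

lemma layered_myc_automorphism:
  assumes f: "automorphism H f" and fW: "f W = U i s" and t: "t \<ge> 1"
  shows "layered_myc G t (\<lambda>v. depth (inv_into VH f v)) i s"
proof -
  let ?g = "inv_into VH f"
  have g: "automorphism H ?g" using f by (rule automorphism_inv_into)
  note bij = automorphism_bij[OF f]
  have gf: "?g (f v) = v" if "v \<in> VH" for v
    using bij_betw_inv_into_left[OF bij that] .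
  have fg: "f (?g v) = v" if "v \<in> VH" for v
    using bij_betw_inv_into_right[OF bij that] .
  have gV: "?g v \<in> VH" if "v \<in> VH" for v
    using bij_betwE[OF automorphism_bij[OF g]] that by blast
  have fV: "f v \<in> VH" if "v \<in> VH" for v
    using bij_betwE[OF bij] that by blast
  have d0: "depth v = 0 \<longleftrightarrow> v = W" if "v \<in> VH" for v
    using that by (cases v) (auto simp: depth_def)
  show ?thesis
  proof unfold_locales
    show "1 \<le> t" by fact
    show "i \<in> V" "s \<le> t" using fV[of W] fW by auto
    show "depth (?g v) = 0 \<longleftrightarrow> v = U i s" if "v \<in> VH" for v
      using d0[OF gV[OF that]] fW fg[OF that] gf[of W] by auto
    show "depth (?g v) \<le> Suc t" if "v \<in> VH" for v
      by (simp add: depth_def split: myc_vertex.split)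
    show "depth (?g u) = Suc (depth (?g v)) \<or> depth (?g v) = Suc (depth (?g u)) \<or>
      depth (?g u) = Suc t \<and> depth (?g v) = Suc t" if "(u, v) \<in> EH" for u v
    proof -
      have "(?g u, ?g v) \<in> EH"
        using automorphism_arc[OF g] that EH_verts[OF that] by blast
      then show ?thesis
        by (cases "?g u"; cases "?g v") (auto simp: depth_def)
    qed
    show "\<exists>u. (u, v) \<in> EH \<and> depth (?g v) = Suc (depth (?g u))"
      if v: "v \<in> VH" and pos: "0 < depth (?g v)" for v
    proof -
      obtain u where u: "(u, ?g v) \<in> EH" "depth (?g v) = Suc (depth u)"
        using depth_pred[OF gV[OF v]] d0[OF gV[OF v]] pos by auto
      have "(f u, v) \<in> EH"
        using automorphism_arc[OF f EH_verts[OF u(1)]] u(1) fg[OF v] by simp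
      then show ?thesis using u gf EH_verts[OF u(1)] by auto
    qed
    show "\<exists>v'\<in>VH. v' \<noteq> v \<and> (\<forall>u\<in>VH. depth (?g u) = min (Suc (depth (?g v))) (Suc t) \<longrightarrow>
        ((v, u) \<in> EH \<longleftrightarrow> (v', u) \<in> EH))" if v: "v \<in> VH" and pos: "0 < depth (?g v)" for v
    proof -
      obtain z where z: "z \<in> VH" "z \<noteq> ?g v"
        "\<And>u. u \<in> VH \<Longrightarrow> depth u = min (Suc (depth (?g v))) (Suc t) \<Longrightarrow>
          ((?g v, u) \<in> EH \<longleftrightarrow> (z, u) \<in> EH)"
        using depth_shadow[OF gV[OF v] _ t] d0[OF gV[OF v]] pos by auto
      show ?thesis
      proof (intro bexI[of _ "f z"] conjI ballI impI)
        show "f z \<in> VH" "f z \<noteq> v" using z fV gf by auto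
        fix u assume u: "u \<in> VH" "depth (?g u) = min (Suc (depth (?g v))) (Suc t)"
        show "(v, u) \<in> EH \<longleftrightarrow> (f z, u) \<in> EH"
          using z(3)[OF gV[OF u(1)] u(2)] automorphism_arc[OF g v u(1)]
            automorphism_arc[OF g fV[OF z(1)] u(1)] gf[OF z(1)] by simp
      qed
    qed
  qed
qed

text \<open>Coloring each copy like its original is proper away from \<open>W\<close>, since every
  such arc projects to an arc of \<open>G\<close>. Moved by \<open>f\<close>, it becomes proper away
  from \<open>U i s\<close>, where an edge avoiding \<open>i\<close> yields an odd cycle through
  \<open>W\<close>.\<close>

lemma bipartite_automorphism_incident:
  assumes f: "automorphism H f" and fW: "f W = U i s"
    and col: "\<And>u v. (u, v) \<in> E \<Longrightarrow> \<chi> u \<noteq> (\<chi> v :: bool)"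
    and ab: "(a, b) \<in> E"
  shows "a = i \<or> b = i"
proof (rule ccontr)
  assume "\<not> ?thesis"
  then have ne: "a \<noteq> i" "b \<noteq> i" by auto
  let ?g = "inv_into VH f"
  have g: "automorphism H ?g" using f by (rule automorphism_inv_into)
  \<comment> \<open>The value \<open>True\<close> is a dummy: the preimage is \<open>W\<close> only
    at \<open>U i s\<close>, which is excluded from all comparisons.\<close>
  define c where "c v = (case ?g v of W \<Rightarrow> True | U l p \<Rightarrow> \<chi> l)" for v
  have proper: "c u \<noteq> c v" if "(u, v) \<in> EH" "u \<noteq> U i s" "v \<noteq> U i s" for u v
  proof -
    note V = EH_verts[OF that(1)]
    have "?g u \<noteq> W" "?g v \<noteq> W"
      using that fW bij_betw_inv_into_right[OF automorphism_bij[OF f]] V by metis+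
    moreover have "(?g u, ?g v) \<in> EH" using automorphism_arc[OF g V] that(1) by simp
    ultimately show ?thesis
      by (cases "?g u"; cases "?g v") (auto simp: c_def col)
  qed
  \<comment> \<open>Starting from the edge in level 0, the two crossing arcs between consecutive
    levels swap the colors of the copies of \<open>a\<close> and \<open>b\<close>. At level
    \<open>t\<close> both copies are adjacent to \<open>W\<close>, which two colors do not
    allow.\<close>
  have cyc: "c (U a p) \<noteq> c (U b p)" if "p \<le> t" for p
    using that
  proof (induction p)
    case 0
    then show ?case using proper[of "U a 0" "U b 0"] ab ne by simp
  next
    case (Suc p)
    have "c (U a (Suc p)) \<noteq> c (U b p)" "c (U a p) \<noteq> c (U b (Suc p))"
      using proper[of "U a (Suc p)" "U b p"] proper[of "U a p" "U b (Suc p)"] ab Suc.prems ne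
      by simp_all
    moreover have "c (U a p) \<noteq> c (U b p)" using Suc by simp
    ultimately show ?case by blast
  qed
  have "c (U a t) \<noteq> c W" "c (U b t) \<noteq> c W"
    using proper[of "U a t" W] proper[of "U b t" W] ne E_verts[OF ab] by simp_all
  then show False using cyc[of t] by auto
qed

end

section \<open>Automorphisms fix \<open>W\<close> and are lifts\<close>

locale twin_free_myc = myc +
  assumes twin_free: "twin_free G" and det_ge_2: "det_number G \<ge> 2" and t_ge_1: "t \<ge> 1"
begin

text \<open>If all edges met \<open>i\<close>, all other vertices would be twins with neighborhood
  \<open>{i}\<close>, so there would be at most one of them, and fixing \<open>i\<close> would fix
  everything.\<close>

lemma ex_arc_avoiding: "\<exists>a b. (a, b) \<in> E \<and> a \<noteq> i \<and> b \<noteq> i" if i: "i \<in> V"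
proof (rule ccontr)
  assume "\<not> ?thesis"
  then have star: "a = i \<or> b = i" if "(a, b) \<in> E" for a b using that by blast
  have "nbhd G v = {i}" if "v \<in> V" "v \<noteq> i" for v
    using E_ex[OF that(1)] star that(2) by (auto simp: nbhd_def)
  then have eq: "u = v" if "u \<in> V" "v \<in> V" "u \<noteq> i" "v \<noteq> i" for u v
    using twin_free that unfolding twin_free_def by metis
  have "determining G {i}"
    unfolding determining_def
  proof (intro conjI allI impI ballI)
    fix f v assume f: "automorphism G f \<and> (\<forall>v\<in>{i}. f v = v)" and v: "v \<in> V"
    then have bij: "bij_betw f V V" and "f i = i" by (auto simp: automorphism_def)
    show "f v = v"
    proof (cases "v = i")
      case False
      then have "f v \<noteq> i"
        using bij_betw_imp_inj_on[OF bij] v i \<open>f i = i\<close> by (metis inj_onD)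
      then show ?thesis using eq False v bij_betwE[OF bij] by blast
    qed (use \<open>f i = i\<close> in simp)
  qed (use i in simp)
  from det_number_le[OF this] det_ge_2 show False by simp
qed

lemma automorphism_W:
  assumes f: "automorphism H f"
  shows "f W = W"
proof (cases "f W")
  case (U i s)
  interpret L: layered_myc G t "\<lambda>v. depth (inv_into VH f v)" i s
    using layered_myc_automorphism[OF f U t_ge_1] .
  obtain a b where ab: "(a, b) \<in> E" "a \<noteq> i" "b \<noteq> i"
    using ex_arc_avoiding[OF L.root(1)] by blast
  show ?thesis
  proof (cases "s = t")
    case True
    then show ?thesis using L.top_root_incident ab by blast
  next
    case False
    \<comment> \<open>Adjacent vertices of level 0 have distances differing by one unless both are
      at distance \<open>t + 1\<close>, which \<open>no_far_base_vertex\<close> excludes.\<close>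
    define \<chi> where "\<chi> l = even (depth (inv_into VH f (U l 0)))" for l
    have "\<chi> u \<noteq> \<chi> v" if uv: "(u, v) \<in> E" for u v
      using L.arc[of "U u 0" "U v 0"] L.no_far_base_vertex[of u] False L.root(2)
        uv E_verts(1)[OF uv] by (auto simp: \<chi>_def)
    then show ?thesis using bipartite_automorphism_incident[OF f U] ab by blast
  qed
qed

text \<open>Induction downwards from level \<open>t\<close>, for all automorphisms at once. A vertex
  cannot move up, because the inverse already preserves the higher level; it cannot move down,
  because it has a neighbor one level up (or \<open>W\<close>) whose level is preserved.\<close>

lemma automorphism_level:
  assumes "automorphism H f" "l \<in> V" "p \<le> t"
  shows "\<exists>m\<in>V. f (U l p) = U m p"
  using assms
proof (induction "t - p" arbitrary: f l p rule: less_induct)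
  case less
  note f = less.prems(1)
  note bij = automorphism_bij[OF f]
  have lp: "U l p \<in> VH" using less.prems by simp
  have "f (U l p) \<noteq> W"
    using automorphism_W[OF f] bij_betw_imp_inj_on[OF bij] lp W_VH
    by (metis inj_onD myc_vertex.distinct(1))
  then obtain m q where mq: "f (U l p) = U m q" by (cases "f (U l p)") auto
  have "U m q \<in> VH" using bij_betwE[OF bij] lp mq by metis
  then have m: "m \<in> V" "q \<le> t" by auto
  have "\<not> p < q"
  proof
    assume pq: "p < q"
    have "\<exists>m'\<in>V. inv_into VH f (U m q) = U m' q"
      by (rule less.hyps) (use pq m automorphism_inv_into[OF f] in auto)
    moreover have "inv_into VH f (U m q) = U l p"
      using bij_betw_inv_into_left[OF bij lp] mq by simp
    ultimately show False using pq by auto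
  qed
  moreover have "p \<le> q"
  proof (cases "p = t")
    case True
    then have "(f (U l p), f W) \<in> EH"
      using automorphism_arc[OF f lp W_VH] less.prems by simp
    then show ?thesis using automorphism_W[OF f] mq True by simp
  next
    case False
    obtain n where n: "(l, n) \<in> E" using E_ex less.prems by blast
    have nV: "n \<in> V" using E_verts[OF n] by simp
    obtain x where x: "f (U n (Suc p)) = U x (Suc p)"
      using less.hyps[of "Suc p" f n] False less.prems nV by force
    have "(f (U l p), f (U n (Suc p))) \<in> EH"
      using automorphism_arc[OF f lp, of "U n (Suc p)"] n nV False less.prems by simp
    then show ?thesis using x mq by auto
  qed
  ultimately show ?case using mq m by auto
qed

text \<open>Level 0 defines \<sigma>. A vertex at level \<open>p + 1\<close> is determined by its
  neighbors at level \<open>p\<close>, as \<open>G\<close> is twin-free, so \<sigma> propagates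
  upwards.\<close>

lemma automorphism_is_lift:
  assumes f: "automorphism H f"
  obtains \<sigma> where "automorphism G \<sigma>" "\<And>l p. l \<in> V \<Longrightarrow> p \<le> t \<Longrightarrow> f (U l p) = U (\<sigma> l) p"
proof -
  note bij = automorphism_bij[OF f]
  have "\<forall>l\<in>V. \<exists>m. m \<in> V \<and> f (U l 0) = U m 0"
    using automorphism_level[OF f] by blast
  then obtain \<sigma> where \<sigma>: "\<And>l. l \<in> V \<Longrightarrow> \<sigma> l \<in> V" "\<And>l. l \<in> V \<Longrightarrow> f (U l 0) = U (\<sigma> l) 0"
    by metis
  have "inj_on \<sigma> V"
  proof (rule inj_onI)
    fix u v assume uv: "u \<in> V" "v \<in> V" "\<sigma> u = \<sigma> v"
    then have "f (U u 0) = f (U v 0)" using \<sigma>(2) by simp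
    then have "U u 0 = U v 0"
      using bij_betw_imp_inj_on[OF bij] uv by (elim inj_onD) auto
    then show "u = v" by simp
  qed
  then have bij\<sigma>: "bij_betw \<sigma> V V"
    using \<sigma>(1) by (simp add: bij_betw_def endo_inj_surj image_subset_iff)
  have arcs: "(\<sigma> u, \<sigma> v) \<in> E \<longleftrightarrow> (u, v) \<in> E" if "u \<in> V" "v \<in> V" for u v
    using automorphism_arc[OF f, of "U u 0" "U v 0"] \<sigma> that by simp
  have "f (U l p) = U (\<sigma> l) p" if "l \<in> V" "p \<le> t" for l p
    using that
  proof (induction p arbitrary: l)
    case 0
    then show ?case using \<sigma>(2) by simp
  next
    case (Suc p)
    obtain m where m: "m \<in> V" "f (U l (Suc p)) = U m (Suc p)"
      using automorphism_level[OF f Suc.prems] by blast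
    have "(m, u) \<in> E \<longleftrightarrow> (\<sigma> l, u) \<in> E" if u: "u \<in> V" for u
    proof -
      obtain v where v: "v \<in> V" "u = \<sigma> v"
        using bij\<sigma> u by (auto simp: bij_betw_def)
      have "f (U v p) = U u p" using Suc v by simp
      then have "(m, u) \<in> E \<longleftrightarrow> (f (U l (Suc p)), f (U v p)) \<in> EH"
        using m Suc.prems by auto
      also have "\<dots> \<longleftrightarrow> (l, v) \<in> E"
        using automorphism_arc[OF f, of "U l (Suc p)" "U v p"] Suc.prems v by auto
      also have "\<dots> \<longleftrightarrow> (\<sigma> l, u) \<in> E" using arcs Suc.prems v by simp
      finally show ?thesis .
    qed
    then have "nbhd G m = nbhd G (\<sigma> l)"
      unfolding nbhd_def using E_verts(2) by blast
    then show ?case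
      using twin_free m \<sigma>(1) Suc.prems unfolding twin_free_def by metis
  qed
  moreover have "automorphism G \<sigma>" using bij\<sigma> arcs by (simp add: automorphism_def)
  ultimately show thesis using that by blast
qed

lemma lift_automorphism:
  assumes \<sigma>: "automorphism G \<sigma>"
  shows "automorphism H (\<lambda>v. case v of W \<Rightarrow> W | U l p \<Rightarrow> U (\<sigma> l) p)" (is "automorphism H ?f")
proof -
  have bij: "bij_betw \<sigma> V V"
    and arcs: "\<And>u v. u \<in> V \<Longrightarrow> v \<in> V \<Longrightarrow> (\<sigma> u, \<sigma> v) \<in> E \<longleftrightarrow> (u, v) \<in> E"
    using \<sigma> by (auto simp: automorphism_def)
  have \<sigma>V: "\<sigma> v \<in> V" if "v \<in> V" for v using bij_betwE[OF bij] that by blast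
  have "inj_on ?f VH"
  proof (rule inj_onI)
    fix u v assume "u \<in> VH" "v \<in> VH" "?f u = ?f v"
    then show "u = v"
      using bij_betw_imp_inj_on[OF bij] by (cases u; cases v) (auto dest: inj_onD)
  qed
  moreover have fVH: "?f v \<in> VH" if "v \<in> VH" for v
    using that \<sigma>V by (cases v) auto
  ultimately have "bij_betw ?f VH VH"
    using finite_VH by (simp add: bij_betw_def endo_inj_surj image_subset_iff)
  moreover have "(?f u, ?f v) \<in> EH \<longleftrightarrow> (u, v) \<in> EH" if "u \<in> VH" "v \<in> VH" for u v
    using that \<sigma>V arcs by (cases u; cases v) auto
  ultimately show ?thesis by (auto simp: automorphism_def)
qed

section \<open>The determining number\<close>

lemma finite_determining:
  assumes "determining G S"
  shows "finite S"
  using assms finite_subset[OF _ pair_finite_verts] by (simp add: determining_def)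

text \<open>Automorphisms of \<open>H\<close> correspond to those of \<open>G\<close>, so a
  determining set of \<open>G\<close> can be placed in level 0, and one of \<open>H\<close> can be
  projected to \<open>G\<close>.\<close>

lemma det_number_mycielskian: "det_number H = det_number G"
proof (rule antisym)
  obtain S where S: "determining G S" "card S = det_number G"
    by (rule determining_det_number)
  have "determining H ((\<lambda>l. U l 0) ` S)"
    unfolding determining_def
  proof (intro conjI allI impI ballI)
    show "(\<lambda>l. U l 0) ` S \<subseteq> VH" using S(1) by (auto simp: determining_def)
    fix f v
    assume f: "automorphism H f \<and> (\<forall>v\<in>(\<lambda>l. U l 0) ` S. f v = v)" and v: "v \<in> VH"
    obtain \<sigma> where \<sigma>: "automorphism G \<sigma>"
      "\<And>l p. l \<in> V \<Longrightarrow> p \<le> t \<Longrightarrow> f (U l p) = U (\<sigma> l) p"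
      using automorphism_is_lift f by blast
    have "\<sigma> l = l" if "l \<in> S" for l
      using \<sigma>(2)[of l 0] f that S(1) by (auto simp: determining_def)
    then have "\<sigma> l = l" if "l \<in> V" for l
      using S(1) \<sigma>(1) that by (auto simp: determining_def)
    then show "f v = v" using \<sigma>(2) v f automorphism_W by (cases v) auto
  qed
  from det_number_le[OF this] show "det_number H \<le> det_number G"
    using S finite_determining card_image_le order_trans by metis
next
  obtain S where S: "determining H S" "card S = det_number H"
    by (rule determining_det_number)
  have finS: "finite S"
    using S(1) finite_subset[OF _ finite_VH] by (simp add: determining_def)
  \<comment> \<open>\<open>W\<close> projects to nothing, since every lift fixes it anyway.\<close>
  define pr where "pr v = (case v of W \<Rightarrow> {} | U l p \<Rightarrow> {l :: 'a})" for v
  define T where "T = (\<Union>v\<in>S. pr v)"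
  have T: "determining G T"
    unfolding determining_def
  proof (intro conjI allI impI ballI)
    show "T \<subseteq> V"
      using S(1) by (auto simp: T_def pr_def determining_def split: myc_vertex.splits)
    fix \<sigma> v assume \<sigma>: "automorphism G \<sigma> \<and> (\<forall>v\<in>T. \<sigma> v = v)" and v: "v \<in> V"
    let ?f = "\<lambda>v. case v of W \<Rightarrow> W | U l p \<Rightarrow> U (\<sigma> l) p"
    have "?f x = x" if "x \<in> S" for x
      using \<sigma> that by (cases x) (force simp: T_def pr_def)+
    then have "?f (U v 0) = U v 0"
      using S(1) lift_automorphism[of \<sigma>] \<sigma> v U_VH[of v 0] unfolding determining_def by blast
    then show "\<sigma> v = v" by simp
  qed
  have "card T \<le> (\<Sum>v\<in>S. card (pr v))"
    unfolding T_def by (rule card_UN_le[OF finS])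
  also have "\<dots> \<le> (\<Sum>v\<in>S. 1)"
    by (rule sum_mono) (simp add: pr_def split: myc_vertex.split)
  finally show "det_number G \<le> det_number H"
    using det_number_le[OF T] S(2) by simp
qed

section \<open>Distinguishing number and cost\<close>

text \<open>Give the \<open>l\<close>-th vertex of a determining set of \<open>G\<close> its own nonempty set of levels, and
  color its copies at those levels red: a color-preserving automorphism fixes every such vertex.\<close>

lemma distinguishing_2_coloring:
  assumes r: "det_number G + 1 \<le> 2 ^ r" "r \<le> Suc t"
  obtains c where "distinguishing H 2 c"
    "2 * card (color_class H c 1) \<le> (det_number G + 1) * r"
proof -
  obtain S where S: "determining G S" "card S = det_number G"
    by (rule determining_det_number)
  have finS: "finite S" and SV: "S \<subseteq> V"
    using S(1) finite_determining by (auto simp: determining_def)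
  \<comment> \<open>One set more than \<open>S\<close> has vertices: removing the empty set leaves
    exactly one nonempty label per vertex and the same total size.\<close>
  obtain F where F: "F \<subseteq> Pow {..<r}" "card F = det_number G + 1" "{} \<in> F"
    "2 * (\<Sum>A\<in>F. card A) \<le> (det_number G + 1) * r"
    using small_subset_family[OF r(1)] by auto
  have finF: "finite F" using F(1) finite_subset by auto
  obtain A where A: "bij_betw A S (F - {{}})"
    using finite_same_card_bij[OF finS, of "F - {{}}"] finF F(2,3) S(2) by auto
  have A_level: "A l \<noteq> {}" "A l \<subseteq> {..<r}" if "l \<in> S" for l
    using bij_betwE[OF A] that F(1) by auto
  have A_le: "p \<le> t" if "p \<in> A l" "l \<in> S" for l p
    using that A_level(2)[of l] r(2) by fastforce
  define c where "c v = (case v of W \<Rightarrow> 0 | U l p \<Rightarrow> if l \<in> S \<and> p \<in> A l then 1 else (0::nat))" for v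
  have red: "U l p \<in> color_class H c 1 \<longleftrightarrow> l \<in> S \<and> p \<in> A l" for l p
    using A_le[of p l] SV by (auto simp: color_class_def c_def)
  have red_eq: "color_class H c 1 = (\<lambda>(l, p). U l p) ` (SIGMA l:S. A l)"
  proof (rule set_eqI)
    fix v show "v \<in> color_class H c 1 \<longleftrightarrow> v \<in> (\<lambda>(l, p). U l p) ` (SIGMA l:S. A l)"
      using red by (cases v) (auto simp: color_class_def c_def)
  qed
  have "card (color_class H c 1) = card (SIGMA l:S. A l)"
    unfolding red_eq by (rule card_image) (auto intro!: inj_onI)
  also have "\<dots> = (\<Sum>l\<in>S. card (A l))"
    using finS finite_subset[OF A_level(2)] by (intro card_SigmaI) auto
  also have "\<dots> = (\<Sum>B\<in>F - {{}}. card B)"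
    by (rule sum.reindex_bij_betw[OF A])
  also have "\<dots> = (\<Sum>B\<in>F. card B)"
    using finF by (intro sum.mono_neutral_left) auto
  finally have size: "2 * card (color_class H c 1) \<le> (det_number G + 1) * r"
    using F(4) by simp
  have "distinguishing H 2 c"
    unfolding distinguishing_def
  proof (intro conjI allI impI ballI)
    show "c ` VH \<subseteq> {..<2}" by (auto simp: c_def split: myc_vertex.split)
    fix f v
    assume f: "automorphism H f \<and> (\<forall>i<2. f ` color_class H c i = color_class H c i)"
      and v: "v \<in> VH"
    obtain \<sigma> where \<sigma>: "automorphism G \<sigma>"
      "\<And>l p. l \<in> V \<Longrightarrow> p \<le> t \<Longrightarrow> f (U l p) = U (\<sigma> l) p"
      using automorphism_is_lift f by blast
    note bij = automorphism_bij[of f]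
    have pres: "f x \<in> color_class H c 1 \<longleftrightarrow> x \<in> color_class H c 1" if "x \<in> VH" for x
    proof -
      have "f ` color_class H c 1 = color_class H c 1" using f by simp
      moreover have "color_class H c 1 \<subseteq> VH" by (auto simp: color_class_def)
      moreover have "inj_on f VH" using bij f by (simp add: bij_betw_def)
      ultimately show ?thesis using that inj_on_image_mem_iff by metis
    qed
    have "\<sigma> l = l" if l: "l \<in> S" for l
    proof -
      have mem: "\<sigma> l \<in> S \<and> p \<in> A (\<sigma> l) \<longleftrightarrow> p \<in> A l" if "p \<le> t" for p
        using pres[of "U l p"] \<sigma>(2)[of l p] red l SV that by auto
      obtain p where "p \<in> A l" using A_level(1)[OF l] by blast
      then have \<sigma>S: "\<sigma> l \<in> S" using mem[of p] A_le l by blast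
      have "A (\<sigma> l) = A l"
      proof (rule set_eqI)
        fix p show "p \<in> A (\<sigma> l) \<longleftrightarrow> p \<in> A l"
          using mem[of p] \<sigma>S A_le[of p] l by blast
      qed
      then show ?thesis using bij_betw_imp_inj_on[OF A] \<sigma>S l by (meson inj_onD)
    qed
    then have "\<sigma> l = l" if "l \<in> V" for l
      using S(1) \<sigma>(1) that by (auto simp: determining_def)
    then show "f v = v" using \<sigma>(2) v f automorphism_W by (cases v) auto
  qed
  then show thesis using that size by blast
qed

text \<open>The vertex \<open>W\<close> rules out \<open>d = 0\<close>. With one color every
  automorphism preserves the classes, so the empty set would be determining, although the
  determining number is at least 2.\<close>

lemma not_distinguishing_less_2:
  assumes "d < 2"
  shows "\<not> distinguishing H d c"
proof
  assume dist: "distinguishing H d c"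
  then have c: "c ` VH \<subseteq> {..<d}" by (auto simp: distinguishing_def)
  then have "c W < d" using W_VH by blast
  then have d: "d = 1" using assms by simp
  have all: "color_class H c 0 = VH" using c d by (auto simp: color_class_def)
  have "determining H {}"
    unfolding determining_def
  proof (intro conjI allI impI)
    fix f assume f: "automorphism H f \<and> (\<forall>v\<in>{}. f v = v)"
    then have "\<forall>i<d. f ` color_class H c i = color_class H c i"
      using automorphism_bij[of f] all d by (simp add: bij_betw_def)
    then show "\<forall>v\<in>VH. f v = v" using dist f by (auto simp: distinguishing_def)
  qed simp
  from det_number_le[OF this] show False
    using det_number_mycielskian det_ge_2 by simp
qed

end

theorem theorem3:
  fixes G :: "'a pair_pre_digraph" and k t :: nat
  assumes "pair_graph G"
    and "twin_free G"
    and "no_isolated G"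
    and "det_number G = k"
    and "k \<ge> 2"
    and "int t \<ge> \<lceil>log 2 (real k + 1)\<rceil> - 1"
  shows "det_number (mycielskian t G) = k
    \<and> dist_number (mycielskian t G) = 2
    \<and> real (cost (mycielskian t G)) \<le> (real k + 1) * real_of_int \<lceil>log 2 (real k + 1)\<rceil> / 2"
proof -
  \<comment> \<open>\<open>k \<ge> 2\<close> makes the ceiling at least 2, which forces
    \<open>t \<ge> 1\<close>.\<close>
  have "log 2 (real k + 1) > log 2 2"
    using assms(5) by (subst log_less_cancel_iff) auto
  then have "log 2 (real k + 1) > 1" by simp
  then have ceil: "\<lceil>log 2 (real k + 1)\<rceil> \<ge> 2" by linarith
  define r where "r = nat \<lceil>log 2 (real k + 1)\<rceil>"
  have r: "int r = \<lceil>log 2 (real k + 1)\<rceil>" unfolding r_def by (rule nat_0_le) (use ceil in linarith)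
  have rt: "r \<le> Suc t" "t \<ge> 1" using r ceil assms(6) by linarith+
  have "real k + 1 = 2 powr log 2 (real k + 1)" by simp
  also have "\<dots> \<le> 2 powr real r"
    using r by (intro powr_mono) (simp_all, linarith)
  also have "\<dots> = 2 ^ r" by (simp add: powr_realpow)
  finally have "real (k + 1) \<le> real (2 ^ r)" by simp
  then have kr: "k + 1 \<le> 2 ^ r" by (simp only: of_nat_le_iff)
  interpret twin_free_myc G t
    using assms rt by (simp add: twin_free_myc_def myc_def twin_free_myc_axioms_def)
  obtain c where c: "distinguishing H 2 c" "2 * card (color_class H c 1) \<le> (k + 1) * r"
    using distinguishing_2_coloring kr rt(1) assms(4) by metis
  have "dist_number H = 2"
    unfolding dist_number_def
  proof (rule Least_equality)
    show "\<exists>c. distinguishing H 2 c" using c(1) by blast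
    show "2 \<le> d" if "\<exists>c. distinguishing H d c" for d
      using that not_distinguishing_less_2 not_le by metis
  qed
  \<comment> \<open>The red class alone bounds the smaller class, whichever of the two that
    is.\<close>
  moreover have "cost H \<le> min (card (color_class H c 0)) (card (color_class H c 1))"
    unfolding cost_def by (rule Least_le) (use c(1) in blast)
  then have "2 * cost H \<le> (k + 1) * r" using c(2) by linarith
  then have "real (2 * cost H) \<le> real ((k + 1) * r)" by (simp only: of_nat_le_iff)
  then have "real (cost H) \<le> (real k + 1) * real_of_int \<lceil>log 2 (real k + 1)\<rceil> / 2"
    unfolding r[symmetric] by (simp add: algebra_simps)
  ultimately show ?thesis using det_number_mycielskian assms(4) by simp
qed

end
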